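(* Let $(A,\mu,\alpha,B)$ be a quadratic Hom-Novikov superalgebra over a field $\mathbf{F}$. If $\alpha$ is an automorphism, then $(A,\mu,\alpha)$ is a Hom-associative superalgebra.
   Context: $\mathbf{F}$ is an arbitrary field. All graded spaces are $\mathbb{Z}_2$-graded, $A=A_{\bar 0}\oplus A_{\bar 1}$, $|x|$ is the degree of a homogeneous element $x$, and identities involving signs are required for all homogeneous elements. A linear map $A\to A$ is even if it preserves degree; a bilinear map $A\times A\to A$ is even if degrees add. We write $\mu(x,y)=xy$. A Hom-Novikov superalgebra is a triple $(A,\mu,\alpha)$, where $A$ is a $\mathbb{Z}_2$-graded vector space, $\mu$ is an even bilinear product and $\alpha:A\to A$ is an even linear map, such that for all homogeneous $x,y,z$: (1) $\alpha(xy)=\alpha(x)\alpha(y)$; (2) $(xy)\alpha(z)-\alpha(x)(yz)=(-1)^{|x||y|}\big((yx)\alpha(z)-\alpha(y)(xz)\big)$; (3) $(xy)\alpha(z)=(-1)^{|y||z|}(xz)\alpha(y)$. A quadratic Hom-Novikov superalgebra is a quadruple $(A,\mu,\alpha,B)$, where $(A,\mu,\alpha)$ is a Hom-Novikov superalgebra and $B:A\times A\to\mathbf{F}$ is a bilinear form that is even ($B(A_{\bar 0},A_{\bar 1})=B(A_{\bar 1},A_{\bar 0})=0$), supersymmetric ($B(x,y)=(-1)^{|x||y|}B(y,x)$), non-degenerate ($B(x,y)=0$ for all $y$ implies $x=0$), and satisfies $B(\alpha(x),yz)=B(xy,\alpha(z))$ for all $x,y,z\in A$. A Hom-associative superalgebra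 is a triple $(A,\mu,\alpha)$, where $A$ is $\mathbb{Z}_2$-graded, $\mu$ is even bilinear and $\alpha$ is linear, with $\alpha(xy)=\alpha(x)\alpha(y)$ and $(xy)\alpha(z)=\alpha(x)(yz)$ for all $x,y,z\in A$. *)

theory Defs
  imports HOL.Vector_Spaces "HOL-Library.Z2"
begin

text \<open>The group of degrees is the type \<open>bit\<close> (the integers modulo 2). The graded space is the
  whole type \<open>'a\<close>, with scalar multiplication \<open>scale\<close> over the field \<open>'k\<close>;
  \<open>A i\<close> is the component of degree \<open>i\<close>.\<close>

locale super_vector_space = vector_space scale
  for scale :: "'k::field \<Rightarrow> 'a::ab_group_add \<Rightarrow> 'a" +
  fixes A :: "bit \<Rightarrow> 'a set"
  assumes subspace_component: "subspace (A i)"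
    and components_span: "\<exists>x0\<in>A 0. \<exists>x1\<in>A 1. x = x0 + x1"
    and components_inter: "A 0 \<inter> A 1 = {0}"

text \<open>The sign \<open>(-1)\<^sup>i\<^sup>j\<close>; only the parity of the exponent matters.\<close>

definition super_sign :: "bit \<Rightarrow> bit \<Rightarrow> 'k::field"
  where "super_sign i j = (- 1) ^ (if i * j = 1 then 1 else 0 :: nat)"

definition bilinear_over ::
  "('k::field \<Rightarrow> 'a::ab_group_add \<Rightarrow> 'a) \<Rightarrow> ('k \<Rightarrow> 'b::ab_group_add \<Rightarrow> 'b) \<Rightarrow> ('a \<Rightarrow> 'a \<Rightarrow> 'b) \<Rightarrow> bool"
  where "bilinear_over s t f \<longleftrightarrow>
    (\<forall>x. Vector_Spaces.linear s t (\<lambda>y. f x y)) \<and> (\<forall>y. Vector_Spaces.linear s t (\<lambda>x. f x y))"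

definition even_map :: "(bit \<Rightarrow> 'a set) \<Rightarrow> ('a \<Rightarrow> 'a) \<Rightarrow> bool"
  where "even_map A f \<longleftrightarrow> (\<forall>i. \<forall>x\<in>A i. f x \<in> A i)"

locale superalgebra = super_vector_space scale A
  for scale :: "'k::field \<Rightarrow> 'a::ab_group_add \<Rightarrow> 'a" and A :: "bit \<Rightarrow> 'a set" +
  fixes mu :: "'a \<Rightarrow> 'a \<Rightarrow> 'a"
  assumes mu_bilinear: "bilinear_over scale scale mu"
    and mu_even: "x \<in> A i \<Longrightarrow> y \<in> A j \<Longrightarrow> mu x y \<in> A (i + j)"

text \<open>Elements are homogeneous when they lie in some \<open>A i\<close>. Zero lies in both components, but
  the identities below hold trivially as soon as one argument is zero.\<close>

locale hom_novikov_superalgebra = superalgebra scale A mu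
  for scale :: "'k::field \<Rightarrow> 'a::ab_group_add \<Rightarrow> 'a" and A :: "bit \<Rightarrow> 'a set"
    and mu :: "'a \<Rightarrow> 'a \<Rightarrow> 'a" +
  fixes alpha :: "'a \<Rightarrow> 'a"
  assumes alpha_linear: "Vector_Spaces.linear scale scale alpha"
    and alpha_even: "even_map A alpha"
    and alpha_mult: "x \<in> A i \<Longrightarrow> y \<in> A j \<Longrightarrow> alpha (mu x y) = mu (alpha x) (alpha y)"
    and left_symmetric: "x \<in> A i \<Longrightarrow> y \<in> A j \<Longrightarrow> z \<in> A k \<Longrightarrow>
      mu (mu x y) (alpha z) - mu (alpha x) (mu y z) =
      scale (super_sign i j) (mu (mu y x) (alpha z) - mu (alpha y) (mu x z))"
    and right_commutative: "x \<in> A i \<Longrightarrow> y \<in> A j \<Longrightarrow> z \<in> A k \<Longrightarrow>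
      mu (mu x y) (alpha z) = scale (super_sign j k) (mu (mu x z) (alpha y))"

locale quadratic_hom_novikov_superalgebra = hom_novikov_superalgebra scale A mu alpha
  for scale :: "'k::field \<Rightarrow> 'a::ab_group_add \<Rightarrow> 'a" and A :: "bit \<Rightarrow> 'a set"
    and mu :: "'a \<Rightarrow> 'a \<Rightarrow> 'a" and alpha :: "'a \<Rightarrow> 'a" +
  fixes B :: "'a \<Rightarrow> 'a \<Rightarrow> 'k"
  assumes B_bilinear: "bilinear_over scale (*) B"
    and B_even: "x \<in> A i \<Longrightarrow> y \<in> A j \<Longrightarrow> i \<noteq> j \<Longrightarrow> B x y = 0"
    and B_supersymmetric: "x \<in> A i \<Longrightarrow> y \<in> A j \<Longrightarrow> B x y = super_sign i j * B y x"
    and B_nondegenerate: "(\<forall>y. B x y = 0) \<Longrightarrow> x = 0"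
    and B_invariant: "B (alpha x) (mu y z) = B (mu x y) (alpha z)"

text \<open>Unlike for Hom-Novikov superalgebras, the twisting map is not required to be even here.\<close>

locale hom_associative_superalgebra = superalgebra scale A mu
  for scale :: "'k::field \<Rightarrow> 'a::ab_group_add \<Rightarrow> 'a" and A :: "bit \<Rightarrow> 'a set"
    and mu :: "'a \<Rightarrow> 'a \<Rightarrow> 'a" +
  fixes alpha :: "'a \<Rightarrow> 'a"
  assumes alpha_linear: "Vector_Spaces.linear scale scale alpha"
    and alpha_mult: "alpha (mu x y) = mu (alpha x) (alpha y)"
    and hom_associative: "mu (mu x y) (alpha z) = mu (alpha x) (mu y z)"

definition hom_superalgebra_automorphism ::
  "('k::field \<Rightarrow> 'a::ab_group_add \<Rightarrow> 'a) \<Rightarrow> (bit \<Rightarrow> 'a set) \<Rightarrow> ('a \<Rightarrow> 'a \<Rightarrow> 'a) \<Rightarrow> ('a \<Rightarrow> 'a) \<Rightarrow>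
    ('a \<Rightarrow> 'a) \<Rightarrow> bool"
  where "hom_superalgebra_automorphism scale A mu alpha f \<longleftrightarrow>
    Vector_Spaces.linear scale scale f \<and> even_map A f \<and> bij f \<and>
    (\<forall>x y. f (mu x y) = mu (f x) (f y)) \<and> f \<circ> alpha = alpha \<circ> f"

end

theory Submission imports Defs begin

text \<open>Write \<open>S(x,y,z) = (xy)\<alpha>(z)\<close> and \<open>T(x,y,z) = \<alpha>(x)(yz)\<close>. By invariance
  \<open>B(S(x,y,z), \<alpha>(u)) = B(\<alpha>(x)\<alpha>(y), \<alpha>(z)u)\<close> and, for \<open>u = \<alpha>(v)\<close>, this is
  \<open>B(\<alpha>\<^sup>2(x), T(y,z,v))\<close>. Hence right commutativity of \<open>S\<close> in its last two arguments passes to \<open>T\<close>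
  in its first two arguments, and left symmetry then makes \<open>S\<close> supersymmetric in its first two
  arguments, hence in all three. In particular supercommutators of elements in the image of \<open>\<alpha>\<close>
  are orthogonal to products \<open>\<alpha>(z)u\<close>. As
  \<open>B(\<alpha>\<^sup>2(u), T(x,y,z)) = B(\<alpha>(u)\<alpha>(x), \<alpha>(y)\<alpha>(z))\<close>, moving \<open>u\<close> to the last place by these
  symmetries turns the right-hand side into \<open>B(S(x,y,z), \<alpha>\<^sup>2(u))\<close>, all signs cancelling.\<close>

lemma super_sign_eq: "super_sign i j = (if i = 1 \<and> j = 1 then - 1 else 1)"
  by (cases i; cases j) (simp_all add: super_sign_def)

lemma super_sign_commute: "super_sign i j = super_sign j i"
  by (auto simp: super_sign_eq)

lemma super_sign_square_left [simp]: "super_sign i j * (super_sign i j * c) = c"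
  by (simp add: super_sign_eq)

lemma super_sign_add_left: "super_sign (i + j) k = super_sign i k * super_sign j k"
  by (cases "i = 1"; cases "j = 1") (simp_all add: super_sign_eq)

lemma super_sign_add_right: "super_sign k (i + j) = super_sign k i * super_sign k j"
  by (metis super_sign_add_left super_sign_commute)

context superalgebra
begin

lemma mu_add_left: "mu (x + y) z = mu x z + mu y z"
  and mu_add_right: "mu z (x + y) = mu z x + mu z y"
  using mu_bilinear unfolding bilinear_over_def linear_iff_module_hom
  by (meson module_hom.add)+

text \<open>Reduces statements additive in one argument to homogeneous elements.\<close>

lemma homogeneous_induct [case_names homogeneous add]:
  assumes "\<And>i x. x \<in> A i \<Longrightarrow> P x" and "\<And>x y. P x \<Longrightarrow> P y \<Longrightarrow> P (x + y)"
  shows "P x"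
  using components_span[of x] assms by blast

end

context hom_novikov_superalgebra
begin

lemma alpha_add: "alpha (x + y) = alpha x + alpha y"
  using alpha_linear unfolding linear_iff_module_hom by (rule module_hom.add)

lemma alpha_homogeneous: "x \<in> A i \<Longrightarrow> alpha x \<in> A i"
  using alpha_even by (simp add: even_map_def)

end

context quadratic_hom_novikov_superalgebra
begin

lemma B_add_left: "B (x + y) z = B x z + B y z"
  and B_add_right: "B z (x + y) = B z x + B z y"
  and B_scale_left: "B (scale c x) z = c * B x z"
  using B_bilinear unfolding bilinear_over_def linear_iff_module_hom
  by (meson module_hom.add module_hom.scale)+

lemma B_diff_left: "B (x - y) z = B x z - B y z"
  using B_add_left[of "x - y" y z] by simp

text \<open>Surjectivity of \<open>alpha\<close> gives every test vector the form
  \<open>alpha (alpha u)\<close>, additivity makes \<open>u\<close> homogeneous, and non-degeneracy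
  concludes.\<close>

lemma B_eqI:
  assumes "surj alpha" and "\<And>l u. u \<in> A l \<Longrightarrow> B x (alpha (alpha u)) = B y (alpha (alpha u))"
  shows "x = y"
proof -
  have eq: "B x (alpha (alpha u)) = B y (alpha (alpha u))" for u
    by (induction u rule: homogeneous_induct) (simp_all add: assms(2) alpha_add B_add_right)
  have "B (x - y) w = 0" for w
  proof -
    obtain u where "w = alpha (alpha u)"
      using \<open>surj alpha\<close> by (metis surjD)
    then show ?thesis
      by (simp add: B_diff_left eq)
  qed
  then show ?thesis
    using B_nondegenerate[of "x - y"] by simp
qed

lemma B_left_product:
  assumes "x \<in> A i" "y \<in> A j"
  shows "B (mu (mu x y) (alpha z)) (alpha u) = B (mu (alpha x) (alpha y)) (mu (alpha z) u)"
  using assms by (simp add: B_invariant[symmetric] alpha_mult)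

lemma B_right_product:
  assumes "z \<in> A j" "v \<in> A k"
  shows "B (alpha u) (mu (alpha y) (mu z v)) = B (mu u (alpha y)) (mu (alpha z) (alpha v))"
  using assms by (simp add: B_invariant alpha_mult)

lemma right_product_commute:
  assumes "surj alpha" and x: "x \<in> A i" and y: "y \<in> A j" and z: "z \<in> A k"
  shows "mu (alpha x) (mu y z) = scale (super_sign i j) (mu (alpha y) (mu x z))"
    (is "?T = scale _ ?T'")
proof (rule B_eqI[OF \<open>surj alpha\<close>])
  fix l u assume u: "u \<in> A l"
  let ?u = "alpha (alpha u)"
  have hom: "?u \<in> A l" "?T \<in> A (i + (j + k))" "?T' \<in> A (j + (i + k))"
    using u x y z by (blast intro: alpha_homogeneous mu_even)+
  \<comment> \<open>Both sides equal
    \<open>B (mu (alpha u) (alpha x)) (mu (alpha y) (alpha z))\<close>.\<close>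
  have "B ?u ?T = B (mu (mu u x) (alpha y)) (alpha (alpha z))"
    using u x y z by (simp add: B_right_product B_left_product)
  also have "\<dots> = super_sign i j * B (mu (mu u y) (alpha x)) (alpha (alpha z))"
    by (simp add: right_commutative[OF u x y] B_scale_left)
  also have "\<dots> = super_sign i j * B ?u ?T'"
    using u x y z by (simp add: B_right_product B_left_product)
  \<comment> \<open>Moving \<open>?u\<close> to the right costs the same sign on both sides, as
    \<open>?T\<close> and \<open>?T'\<close> have equal degree.\<close>
  finally show "B ?T ?u = B (scale (super_sign i j) ?T') ?u"
    unfolding B_scale_left B_supersymmetric[OF hom(2,1)] B_supersymmetric[OF hom(3,1)]
      super_sign_add_left by (simp add: mult_ac)
qed

text \<open>By \<open>right_product_commute\<close> the subtracted terms in left symmetry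
  cancel.\<close>

lemma left_product_commute:
  assumes "surj alpha" and "x \<in> A i" and "y \<in> A j" and "z \<in> A k"
  shows "mu (mu x y) (alpha z) = scale (super_sign i j) (mu (mu y x) (alpha z))"
  using left_symmetric[OF assms(2-4)] right_product_commute[OF assms]
  by (simp add: scale_right_diff_distrib)

lemma hom_associative_homogeneous:
  assumes "surj alpha" and x: "x \<in> A i" and y: "y \<in> A j" and z: "z \<in> A k"
  shows "mu (mu x y) (alpha z) = mu (alpha x) (mu y z)" (is "?S = ?T")
proof (rule B_eqI[OF \<open>surj alpha\<close>, symmetric])
  fix l u assume u: "u \<in> A l"
  let ?u = "alpha (alpha u)"
  have hom: "?u \<in> A l" "?T \<in> A (i + (j + k))" "mu (alpha x) (alpha u) \<in> A (i + l)"
      "mu (alpha y) (alpha z) \<in> A (j + k)"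
    using u x y z by (blast intro: alpha_homogeneous mu_even)+
  have "B ?u ?T = B (mu (mu u x) (alpha y)) (alpha (alpha z))"
    using u x y z by (simp add: B_right_product B_left_product)
  also have "\<dots> = super_sign l i * B (mu (mu x u) (alpha y)) (alpha (alpha z))"
    by (simp add: left_product_commute[OF \<open>surj alpha\<close> u x y] B_scale_left)
  \<comment> \<open>Supersymmetry of \<open>B\<close> swaps the two products, which puts
    \<open>u\<close> last.\<close>
  also have "B (mu (mu x u) (alpha y)) (alpha (alpha z))
      = super_sign (i + l) (j + k) * B (mu (alpha y) (alpha z)) (mu (alpha x) (alpha u))"
    using x u by (simp add: B_left_product B_supersymmetric[OF hom(3,4)])
  also have "B (mu (alpha y) (alpha z)) (mu (alpha x) (alpha u)) = B (mu (mu y z) (alpha x)) ?u"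
    using y z by (simp add: B_left_product)
  also have "\<dots> = super_sign k i * super_sign j i * B ?S ?u"
    by (simp add: right_commutative[OF y z x] left_product_commute[OF \<open>surj alpha\<close> y x z]
        B_scale_left)
  \<comment> \<open>Each of the pairs il, jl, kl, ij, ik contributes its sign exactly twice.\<close>
  finally show "B ?T ?u = B ?S ?u"
    unfolding B_supersymmetric[OF hom(2,1)] super_sign_add_left super_sign_add_right
    by (simp add: super_sign_commute mult_ac)
qed

lemma hom_associative:
  assumes "surj alpha"
  shows "mu (mu x y) (alpha z) = mu (alpha x) (mu y z)"
proof (induction x rule: homogeneous_induct)
  case x: (homogeneous i x)
  show ?case
  proof (induction y rule: homogeneous_induct)
    case y: (homogeneous j y)
    show ?case
      by (induction z rule: homogeneous_induct)
        (simp_all add: hom_associative_homogeneous[OF assms x y] alpha_add mu_add_right)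
  qed (simp add: mu_add_left mu_add_right)
qed (simp add: mu_add_left alpha_add)

end

theorem theorem3p9:
  fixes scale :: "'k::field \<Rightarrow> 'a::ab_group_add \<Rightarrow> 'a"
    and A :: "bit \<Rightarrow> 'a set"
    and mu :: "'a \<Rightarrow> 'a \<Rightarrow> 'a"
    and alpha :: "'a \<Rightarrow> 'a"
    and B :: "'a \<Rightarrow> 'a \<Rightarrow> 'k"
  assumes "quadratic_hom_novikov_superalgebra scale A mu alpha B"
    and "hom_superalgebra_automorphism scale A mu alpha alpha"
  shows "hom_associative_superalgebra scale A mu alpha"
proof -
  interpret quadratic_hom_novikov_superalgebra scale A mu alpha B
    by (fact assms(1))
  \<comment> \<open>The automorphism supplies multiplicativity on all elements, beyond the
    homogeneous ones of \<open>alpha_mult\<close>.\<close>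
  have "surj alpha" and mult: "alpha (mu x y) = mu (alpha x) (alpha y)" for x y
    using assms(2) by (auto simp: hom_superalgebra_automorphism_def bij_is_surj)
  then show ?thesis
    by (intro hom_associative_superalgebra.intro hom_associative_superalgebra_axioms.intro
        superalgebra_axioms alpha_linear hom_associative)
qed

end
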